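(* Let $\mathfrak{P}$ be an infinite set of primes with $\sum_{p\le X,\,p\in\mathfrak{P}}\frac{\log p}{p}=\kappa\log X+O(1)$ for some $\kappa\in(0,1]$, and for $y\ge2$ put $\mathfrak{P}(y)=\prod_{p<y,\,p\in\mathfrak{P}}p$. Let $N$ be large, $z\ge1$, and let $\mathcal{A},\mathcal{B}$ be two sets of integers in $[1,N]$. Assume there are parameters $D\ge1$, $\alpha\in(0,1)$, $\lambda\in\mathbb{C}$ and $Y\ge2$ such that the following hold, with implied constants uniform in the sequences involved: (i) for any sequence of complex numbers $(a(d))$ with $|a(d)|\le1$, $$\sum_{\substack{d<D,\ n\in\mathcal{A}\\ d\mid n}}a(d)=\lambda\sum_{\substack{d<D,\ n\in\mathcal{B}\\ d\mid n}}a(d)+O(Y);$$ (ii) for any two sequences of complex numbers $(a(\ell))$, $(b(m))$ with $|a(\ell)|\le1$ and $|b(m)|\le\tau_6(m)$, $$\sum_{\substack{N^\alpha<\ell\le zN^\alpha\\ m:\ \ell m\in\mathcal{A}}}a(\ell)b(m)=\lambda\sum_{\substack{N^\alpha<\ell\le zN^\alpha\\ m:\ \ell m\in\mathcal{B}}}a(\ell)b(m)+O(Y).$$ Then for any $R\ge1$ with $N^\alpha R\le D$ and any sequence $(c_r)_{r\le R}$ with $|c_r|\le1$, $$\sum_{r\le R}c_r\sum_{\substack{n\in\mathcal{A}\\(n,\mathfrak{P}(z))=1\\ r\mid n}}1=\lambda\sum_{r\le R}c_r\sum_{\substack{n\in\mathcal{B}\\(n,\mathfrak{P}(z))=1\\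 r\mid n}}1+O\Bigl(Y\log N+\frac{RN}{z}\Bigr).$$
   Context: $\tau_6(m)$ is the number of ordered $6$-tuples of positive integers with product $m$.
   Formalization: The boundary case $N^\alpha R=D$ with $D$ an integer is excluded, since the claim fails there: with $N=p^8$, $N^\alpha=D=p$, $R=1$, $z=p^2$, $\mathcal A$ the primes in $(N/2,N]$, $\mathcal B=\{p\}$, $\lambda=|\mathcal A|$, (i) and (ii) hold exactly but the conclusion does not. *)

theory Defs
  imports Complex_Main "HOL-Library.Landau_Symbols" "HOL-Computational_Algebra.Primes"
begin

definition tau6 :: "nat \<Rightarrow> nat" where
  "tau6 m = card {xs :: nat list. length xs = 6 \<and> (\<forall>x\<in>set xs. 1 \<le> x) \<and> prod_list xs = m}"

definition has_log_density :: "nat set \<Rightarrow> real \<Rightarrow> bool" where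
  "has_log_density P \<kappa> \<longleftrightarrow>
     (\<lambda>X :: real. (\<Sum>p | p \<in> P \<and> real p \<le> X. ln (real p) / real p) - \<kappa> * ln X) \<in> O[at_top](\<lambda>_. 1)"

(* Equal to 1 when y is at most 2. *)
definition sieve_prod :: "nat set \<Rightarrow> real \<Rightarrow> nat" where
  "sieve_prod P y = \<Prod>{p \<in> P. real p < y}"

definition sum_I :: "nat set \<Rightarrow> real \<Rightarrow> (nat \<Rightarrow> complex) \<Rightarrow> complex" where
  "sum_I S D a = (\<Sum>(d, n) | 1 \<le> d \<and> real d < D \<and> n \<in> S \<and> d dvd n. a d)"

definition sum_II :: "nat set \<Rightarrow> real \<Rightarrow> real \<Rightarrow> (nat \<Rightarrow> complex) \<Rightarrow> (nat \<Rightarrow> complex) \<Rightarrow> complex" where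
  "sum_II S L z a b =
     (\<Sum>(l, m) | L < real l \<and> real l \<le> z * L \<and> 1 \<le> m \<and> l * m \<in> S. a l * b m)"

definition sifted_sum :: "nat set \<Rightarrow> nat set \<Rightarrow> real \<Rightarrow> real \<Rightarrow> (nat \<Rightarrow> complex) \<Rightarrow> complex" where
  "sifted_sum P S z R c =
     (\<Sum>r | 1 \<le> r \<and> real r \<le> R.
        c r * (\<Sum>n | n \<in> S \<and> coprime n (sieve_prod P z) \<and> r dvd n. 1))"

(* In the two hypotheses below K is the implied constant; it is the same for all sequences.

   Pitfall: the range d < D is strict, so for L = N powr \<alpha> and L * R = D with D an integer it
   misses the modulus d = D, and a sieve bound cannot be deduced from the two hypotheses.
   For instance let p be a large prime, N = p ^ 8, L = D = p, R = 1, z = p ^ 2, let A be the set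
   of primes in {N / 2 <.. N}, B = {p}, lam = card A, and sieve by all primes. Every sum_I and
   sum_II of A agrees exactly with lam times that of B, but the sifted sums are card A and 0,
   and card A is not O(ln N + N / p ^ 2). *)

definition type_I_estimate ::
  "real \<Rightarrow> nat set \<Rightarrow> nat set \<Rightarrow> complex \<Rightarrow> real \<Rightarrow> real \<Rightarrow> bool" where
  "type_I_estimate K A B lam D Y \<longleftrightarrow>
     (\<forall>a. (\<forall>d\<ge>1. norm (a d) \<le> 1) \<longrightarrow> norm (sum_I A D a - lam * sum_I B D a) \<le> K * Y)"

definition type_II_estimate ::
  "real \<Rightarrow> nat set \<Rightarrow> nat set \<Rightarrow> complex \<Rightarrow> real \<Rightarrow> real \<Rightarrow> real \<Rightarrow> bool" where
  "type_II_estimate K A B lam L z Y \<longleftrightarrow>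
     (\<forall>a b. (\<forall>l\<ge>1. norm (a l) \<le> 1) \<and> (\<forall>m\<ge>1. norm (b m) \<le> real (tau6 m)) \<longrightarrow>
        norm (sum_II A L z a b - lam * sum_II B L z a b) \<le> K * Y)"

end

theory Submission
  imports Defs
begin

text \<open>Let \<open>L = N powr \<alpha>\<close>. A modulus \<open>r\<close> matters only if it has no sieving prime factor.
  Expand the sieve condition on \<open>n\<close> over the products \<open>d\<close> of distinct sieving primes dividing
  \<open>n\<close>. The terms with \<open>d \<le> L\<close> form a type I sum over the moduli \<open>r * d\<close>, each of which
  determines \<open>r\<close> and \<open>d\<close>. If \<open>d > L\<close>, multiply the primes of \<open>d\<close> in decreasing order until the
  product \<open>l\<close> first exceeds \<open>L\<close>; then \<open>l \<le> z * L\<close>, and summing over the remaining smaller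
  primes leaves the condition that no sieving prime factor of \<open>m = n / l\<close> is smaller than the
  least prime factor of \<open>l\<close>. This inequality between a function of \<open>l\<close> and a function of \<open>m\<close> is
  removed from the type II sum at the cost of a factor \<open>O(ln N)\<close>, by comparing binary digits and
  averaging over signs.\<close>

section \<open>Separation of variables\<close>

text \<open>\<open>E\<close> will be the type II error: the form over \<open>A\<close> minus
  \<open>lam\<close> times the form over \<open>B\<close>. Only products \<open>a l * b m\<close>
  are controlled; linearity extends this to their combinations.\<close>

locale bilinear_bound =
  fixes E :: "('a \<Rightarrow> 'b \<Rightarrow> complex) \<Rightarrow> complex" and H :: real and \<beta> :: "'b \<Rightarrow> real"
  assumes add: "E (\<lambda>l m. f l m + g l m) = E f + E g"
    and scale: "E (\<lambda>l m. k * f l m) = k * E f"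
    and bound: "(\<And>l. norm (a l) \<le> 1) \<Longrightarrow> (\<And>m. norm (b m) \<le> \<beta> m) \<Longrightarrow>
      norm (E (\<lambda>l m. a l * b m)) \<le> H"
begin

text \<open>Averaging over the signs that are constant on blocks removes the off-diagonal blocks.
  The blocks are split off one at a time.\<close>

lemma block_diagonal_partial:
  fixes i :: "'a \<Rightarrow> nat" and k :: "'b \<Rightarrow> nat"
  assumes "\<And>l. norm (a l) \<le> 1" and "\<And>m. norm (b m) \<le> \<beta> m"
  shows "norm (E (\<lambda>l m. if i l = k m \<or> (n \<le> i l \<and> n \<le> k m) then a l * b m else 0)) \<le> H"
  using assms
proof (induction n arbitrary: a b)
  case 0
  then show ?case using bound[of a b] by simp
next
  case (Suc n)
  define f where "f = (\<lambda>a b l m. if i l = k m \<or> (n \<le> i l \<and> n \<le> k m)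
    then a l * b m else (0 :: complex))"
  \<comment> \<open>The new signs keep a product when both indices are at most \<open>n\<close> or
    both exceed \<open>n\<close>, and negate it otherwise. Within \<open>f\<close>, averaging thus
    cancels exactly the terms joining block \<open>n\<close> to a later block.\<close>
  define a' where "a' = (\<lambda>l. if i l \<le> n then a l else - a l)"
  define b' where "b' = (\<lambda>m. if k m \<le> n then b m else - b m)"
  have "(\<lambda>l m. if i l = k m \<or> (Suc n \<le> i l \<and> Suc n \<le> k m) then a l * b m else 0) =
      (\<lambda>l m. 1/2 * (f a b l m + f a' b' l m))"
    by (auto simp: fun_eq_iff f_def a'_def b'_def)
  then have eq: "E (\<lambda>l m. if i l = k m \<or> (Suc n \<le> i l \<and> Suc n \<le> k m) then a l * b m else 0) =
      1/2 * (E (f a b) + E (f a' b'))"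
    by (simp only: scale add)
  have "norm (E (f a b)) \<le> H"
    unfolding f_def by (rule Suc.IH) (use Suc.prems in auto)
  moreover have "norm (E (f a' b')) \<le> H"
    unfolding f_def by (rule Suc.IH) (use Suc.prems in \<open>auto simp: a'_def b'_def\<close>)
  ultimately have "norm (E (f a b) + E (f a' b')) \<le> 2 * H"
    using norm_triangle_ineq[of "E (f a b)" "E (f a' b')"] by linarith
  then show ?case unfolding eq by (simp add: norm_mult)
qed

text \<open>Every row index is below \<open>n\<close>, so after \<open>n\<close> splittings only the
  diagonal blocks remain. The bound does not grow with the number of blocks, so a binary digit will
  cost a single \<open>H\<close>.\<close>

lemma block_diagonal:
  fixes i :: "'a \<Rightarrow> nat" and k :: "'b \<Rightarrow> nat"
  assumes "\<And>l. norm (a l) \<le> 1" and "\<And>m. norm (b m) \<le> \<beta> m" and "\<And>l. i l < n"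
  shows "norm (E (\<lambda>l m. if i l = k m then a l * b m else 0)) \<le> H"
proof -
  have "(i l = k m \<or> (n \<le> i l \<and> n \<le> k m)) = (i l = k m)" for l m
    using assms(3)[of l] by auto
  then show ?thesis
    using block_diagonal_partial[of a b i k n] assms by simp
qed

text \<open>The first binary digit at which \<open>u l\<close> and \<open>w m\<close> differ decides whether \<open>u l < w m\<close>;
  each digit costs one block-diagonal form.\<close>

lemma triangular:
  fixes u :: "'a \<Rightarrow> nat" and w :: "'b \<Rightarrow> nat"
  assumes "\<And>l. norm (a l) \<le> 1" and "\<And>m. norm (b m) \<le> \<beta> m"
    and "\<And>l. u l < 2 ^ J" and "\<And>m. w m < 2 ^ J"
  shows "norm (E (\<lambda>l m. if u l < w m then a l * b m else 0)) \<le> real J * H"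
  using assms
proof (induction J arbitrary: u w)
  case 0
  have "(\<lambda>l m. if u l < w m then a l * b m else 0) = (\<lambda>l m. 0 * 0)"
    using 0 by (auto simp: fun_eq_iff)
  then show ?case using scale[of 0 "\<lambda>_ _. 0"] by simp
next
  case (Suc J)
  \<comment> \<open>When the higher digits agree, \<open>u l < w m\<close> means last digit 0 for
    \<open>u l\<close> and 1 for \<open>w m\<close>. Each parity condition concerns one variable and
    is absorbed into its coefficient.\<close>
  define a' where "a' = (\<lambda>l. if even (u l) then a l else 0)"
  define b' where "b' = (\<lambda>m. if odd (w m) then b m else 0)"
  have less_iff: "(x < y) = (x div 2 < y div 2 \<or> (x div 2 = y div 2 \<and> even x \<and> odd y))" for x y :: nat
    by presburger
  have "(\<lambda>l m. if u l < w m then a l * b m else 0) =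
      (\<lambda>l m. (if u l div 2 < w m div 2 then a l * b m else 0) +
             (if u l div 2 = w m div 2 then a' l * b' m else 0))"
  proof (intro ext)
    fix l m
    show "(if u l < w m then a l * b m else 0) = (if u l div 2 < w m div 2 then a l * b m else 0) +
        (if u l div 2 = w m div 2 then a' l * b' m else 0)"
      unfolding less_iff[of "u l" "w m"] by (simp add: a'_def b'_def)
  qed
  then have eq: "E (\<lambda>l m. if u l < w m then a l * b m else 0) =
      E (\<lambda>l m. if u l div 2 < w m div 2 then a l * b m else 0) +
      E (\<lambda>l m. if u l div 2 = w m div 2 then a' l * b' m else 0)"
    by (simp only: add)
  have half: "x div 2 < 2 ^ J" if "x < 2 ^ Suc J" for x :: nat
    using that by auto
  have "norm (E (\<lambda>l m. if u l div 2 < w m div 2 then a l * b m else 0)) \<le> real J * H"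
    by (rule Suc.IH) (use Suc.prems half in auto)
  moreover have "norm (b' m) \<le> \<beta> m" for m
    using Suc.prems(2)[of m] norm_ge_zero[of "b m"] by (simp add: b'_def del: norm_ge_zero)
  then have "norm (E (\<lambda>l m. if u l div 2 = w m div 2 then a' l * b' m else 0)) \<le> H"
    by (intro block_diagonal[where n = "2 ^ J"]) (use Suc.prems half in \<open>auto simp: a'_def\<close>)
  ultimately show ?case
    unfolding eq by (intro order_trans[OF norm_triangle_ineq]) (simp add: algebra_simps)
qed

end

section \<open>A combinatorial sieve identity\<close>

text \<open>Only the sets \<open>U\<close> containing \<open>Min F\<close> contribute to the second sum, so adjoining \<open>Min F\<close>
  matches its terms with the unpaired terms of the first sum.\<close>

lemma crossing_identity:
  fixes F :: "nat set" and L :: real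
  assumes "finite F" and "\<And>q. q \<in> F \<Longrightarrow> 1 \<le> q" and "1 \<le> L"
  shows "(if F = {} then 1 else 0 :: complex) =
    (\<Sum>T | T \<subseteq> F \<and> real (\<Prod>T) \<le> L. (-1) ^ card T) +
    (\<Sum>U | U \<subseteq> F \<and> U \<noteq> {} \<and> real (\<Prod>(U - {Min U})) \<le> L \<and> L < real (\<Prod>U) \<and>
           (\<forall>q\<in>F. Min U \<le> q). (-1) ^ card U)"
proof (cases "F = {}")
  case True
  have "{T. T \<subseteq> {} \<and> real (\<Prod>T) \<le> L} = {{}}" using assms(3) by auto
  moreover have "{U. U \<subseteq> {} \<and> U \<noteq> {} \<and> real (\<Prod>(U - {Min U})) \<le> L \<and> L < real (\<Prod>U) \<and>
           (\<forall>q\<in>{}. Min U \<le> q)} = ({} :: nat set set)" by auto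
  ultimately show ?thesis unfolding True by (simp only:) simp
next
  case False
  define q where "q = Min F"
  define F' where "F' = F - {q}"
  have q: "q \<in> F" "q \<ge> 1" "\<And>x. x \<in> F \<Longrightarrow> q \<le> x"
    using False assms(1,2) by (auto simp: q_def)
  have fin: "finite T" if "T \<subseteq> F" for T
    using that assms(1) finite_subset by blast
  have F': "F' \<subseteq> F" "q \<notin> F'" "insert q F' = F" "finite F'"
    using q assms(1) by (auto simp: F'_def)
  have prod_ins: "\<Prod>(insert q T) = q * \<Prod>T" if "T \<subseteq> F'" for T
    using that F' fin by (subst prod.insert) (auto intro: finite_subset)
  have card_ins: "card (insert q T) = Suc (card T)" if "T \<subseteq> F'" for T
    using that F' by (subst card_insert_disjoint) (auto intro: finite_subset)
  have Min_ins: "Min (insert q T) = q" if "T \<subseteq> F'" for T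
    using that F' q fin by (intro Min_eqI) (auto intro: finite_subset)
  have inj: "inj_on (insert q) {T. T \<subseteq> F'}"
    using F' by (auto simp: inj_on_def)
  \<comment> \<open>Among the small sets avoiding \<open>q\<close>, \<open>?S1\<close> has those
    still small after adjoining \<open>q\<close> and \<open>?S2\<close> those that then cross
    \<open>L\<close>. The first sum becomes \<open>?S\<close> minus \<open>?S1\<close>, the second
    is minus \<open>?S2\<close>, and these cancel.\<close>
  let ?S = "{T. T \<subseteq> F' \<and> real (\<Prod>T) \<le> L}"
  let ?S1 = "{T. T \<subseteq> F' \<and> real (q * \<Prod>T) \<le> L}"
  let ?S2 = "{T. T \<subseteq> F' \<and> real (\<Prod>T) \<le> L \<and> L < real (q * \<Prod>T)}"
  let ?sg = "\<lambda>T. (-1) ^ card T :: complex"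
  have finS: "finite ?S" "finite ?S1" "finite ?S2"
    using F'(4) by auto
  have sub: "?S1 \<subseteq> ?S"
  proof safe
    fix T assume "T \<subseteq> F'" "real (q * \<Prod>T) \<le> L"
    moreover have "\<Prod>T \<le> q * \<Prod>T" using q by simp
    ultimately show "real (\<Prod>T) \<le> L" by (meson of_nat_le_iff order_trans)
  qed
  have "{T. T \<subseteq> F \<and> real (\<Prod>T) \<le> L} = ?S \<union> insert q ` ?S1" (is "?A = _")
  proof (intro equalityI subsetI)
    fix T assume T: "T \<in> ?A"
    show "T \<in> ?S \<union> insert q ` ?S1"
    proof (cases "q \<in> T")
      case True
      then have "T = insert q (T - {q})" "T - {q} \<subseteq> F'" using T by (auto simp: F'_def)
      moreover from this have "\<Prod>T = q * \<Prod>(T - {q})" using prod_ins by metis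
      then have "real (q * \<Prod>(T - {q})) \<le> L" using T by (simp only: mem_Collect_eq)
      ultimately show ?thesis by blast
    next
      case False
      then show ?thesis using T by (auto simp: F'_def)
    qed
  next
    fix T assume "T \<in> ?S \<union> insert q ` ?S1"
    then show "T \<in> ?A" using prod_ins F' by (auto simp del: of_nat_prod)
  qed
  moreover have "?S \<inter> insert q ` ?S1 = {}" using F' by auto
  ultimately have "sum ?sg ?A = sum ?sg ?S + sum ?sg (insert q ` ?S1)"
    using finS by (simp add: sum.union_disjoint)
  also have "sum ?sg (insert q ` ?S1) = (\<Sum>T\<in>?S1. ?sg (insert q T))"
    by (subst sum.reindex) (auto intro: inj_on_subset[OF inj])
  also have "\<dots> = - sum ?sg ?S1"
    unfolding sum_negf[symmetric] by (rule sum.cong) (auto simp: card_ins)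
  finally have A: "sum ?sg ?A = sum ?sg ?S - sum ?sg ?S1" by simp
  have "{U. U \<subseteq> F \<and> U \<noteq> {} \<and> real (\<Prod>(U - {Min U})) \<le> L \<and> L < real (\<Prod>U) \<and>
      (\<forall>x\<in>F. Min U \<le> x)} = insert q ` ?S2" (is "?B = _")
  proof (intro equalityI subsetI)
    fix U assume U: "U \<in> ?B"
    have "Min U \<in> U" using U fin by auto
    then have "Min U = q" using U q by (intro antisym) auto
    moreover have "q \<in> U" using \<open>Min U \<in> U\<close> calculation by simp
    then have *: "U = insert q (U - {q})" "U - {q} \<subseteq> F'" using U by (auto simp: F'_def)
    moreover from this have "\<Prod>U = q * \<Prod>(U - {q})" using prod_ins by metis
    ultimately have "U - {q} \<in> ?S2" using U by (simp only: mem_Collect_eq)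
    then show "U \<in> insert q ` ?S2"
      using *(1) by blast
  next
    fix U assume "U \<in> insert q ` ?S2"
    then obtain T where T: "U = insert q T" "T \<in> ?S2" by blast
    then have "U - {q} = T" using F' by auto
    then show "U \<in> ?B" using T prod_ins[of T] Min_ins[of T] F' q by (auto simp del: of_nat_prod)
  qed
  then have "sum ?sg ?B = (\<Sum>T\<in>?S2. ?sg (insert q T))"
    by (simp only:) (subst sum.reindex, auto intro: inj_on_subset[OF inj])
  also have "\<dots> = - sum ?sg ?S2"
    unfolding sum_negf[symmetric] by (rule sum.cong) (auto simp: card_ins)
  also have "?S2 = ?S - ?S1" by auto
  also have "sum ?sg (?S - ?S1) = sum ?sg ?S - sum ?sg ?S1"
    using finS sub by (intro sum_diff) auto
  finally show ?thesis using A False by simp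
qed

text \<open>A divisor \<open>r\<close> yields the tuple (r, m/r, 1, 1, 1, 1). The weights on
  \<open>m\<close> in the type II sum are divisor sums, so this brings them within the permitted
  size.\<close>

lemma card_divisors_le_tau6:
  assumes "1 \<le> m"
  shows "card {r. r dvd m} \<le> tau6 m"
proof -
  let ?X = "{xs :: nat list. length xs = 6 \<and> (\<forall>x\<in>set xs. 1 \<le> x) \<and> prod_list xs = m}"
  \<comment> \<open>Finiteness has to be shown first, since \<open>card\<close> of an infinite set
    is 0.\<close>
  have "?X \<subseteq> {xs. set xs \<subseteq> {..m} \<and> length xs = 6}"
  proof safe
    fix xs x assume "x \<in> set xs" "m = prod_list xs"
    then have "x dvd m" using prod_list_dvd by blast
    then show "x \<le> prod_list xs" using assms \<open>m = _\<close> by (auto intro: dvd_imp_le)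
  qed
  then have fin: "finite ?X"
    by (rule finite_subset) (rule finite_lists_length_eq, simp)
  let ?f = "\<lambda>r. [r, m div r, 1, 1, 1, 1]"
  have "?f ` {r. r dvd m} \<subseteq> ?X"
    using assms by (auto simp: Suc_le_eq dvd_div_eq_0_iff intro!: Nat.gr0I)
  moreover have "inj_on ?f {r. r dvd m}" by (auto simp: inj_on_def)
  ultimately show ?thesis
    unfolding tau6_def using fin by (metis (lifting) card_image card_mono)
qed


section \<open>Decomposition of the sifted sum\<close>

locale sieve =
  fixes Q :: "nat set"
  assumes finite_Q: "finite Q" and prime_Q: "q \<in> Q \<Longrightarrow> prime q"
begin

text \<open>Subsets of \<open>F n\<close> stand for the squarefree divisors of \<open>n\<close>
  composed of sieving primes; \<open>F n = {}\<close> says that \<open>n\<close> survives the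
  sieve.\<close>

definition F :: "nat \<Rightarrow> nat set" where
  "F n = {q \<in> Q. q dvd n}"

lemma F_subset: "F n \<subseteq> Q"
  by (auto simp: F_def)

lemma finite_F: "finite (F n)"
  using finite_subset[OF F_subset finite_Q] .

lemma F_ge_1: "q \<in> F n \<Longrightarrow> 1 \<le> q"
  using prime_Q prime_ge_1_nat by (auto simp: F_def)

text \<open>A prime dividing a product of primes is one of them. So a set of sieving primes can be
  recovered from its product, on which both reindexings below rely.\<close>

lemma F_prod:
  assumes "T \<subseteq> Q"
  shows "F (\<Prod>T) = T"
proof -
  have "q dvd \<Prod>T \<longleftrightarrow> q \<in> T" if "q \<in> Q" for q
  proof -
    have "finite T" using assms finite_Q finite_subset by blast
    then have "q dvd \<Prod>T \<longleftrightarrow> (\<exists>x\<in>T. q dvd x)"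
      using prime_dvd_prod_iff[of T q "\<lambda>x. x"] prime_Q that by auto
    then show ?thesis
      using primes_dvd_imp_eq[OF prime_Q[OF that] prime_Q] assms by (metis dvd_refl subsetD)
  qed
  then show ?thesis using assms by (auto simp: F_def)
qed

lemma F_mult: "F (a * b) = F a \<union> F b"
  using prime_Q by (auto simp: F_def prime_dvd_mult_iff)

lemma F_dvd: "a dvd b \<Longrightarrow> F a \<subseteq> F b"
  by (auto simp: F_def)

lemma coprime_prod_iff:
  assumes "T \<subseteq> Q"
  shows "coprime n (\<Prod>T) \<longleftrightarrow> F n \<inter> T = {}"
proof
  assume "F n \<inter> T = {}"
  then have "coprime n q" if "q \<in> T" for q
    using that assms prime_Q prime_imp_coprime[of q n] by (auto simp: F_def coprime_commute)
  then show "coprime n (\<Prod>T)" by (rule prod_coprime_right)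
next
  assume *: "coprime n (\<Prod>T)"
  show "F n \<inter> T = {}"
  proof (rule ccontr)
    assume "F n \<inter> T \<noteq> {}"
    then obtain q where q: "q dvd n" "q \<in> T" by (auto simp: F_def)
    moreover have "finite T" using assms finite_Q finite_subset by blast
    ultimately have "q dvd \<Prod>T" by (intro dvd_prodI[of T q "\<lambda>x. x", simplified]) auto
    with * q have "is_unit q" by (metis coprime_common_divisor)
    then show False using q assms prime_Q by (metis not_prime_unit subsetD)
  qed
qed

lemma prod_dvd:
  assumes "T \<subseteq> F n"
  shows "\<Prod>T dvd n"
proof -
  have "finite T" using assms finite_F finite_subset by blast
  then show ?thesis using assms
  proof (induction T)
    case (insert q T)
    then have "T \<subseteq> Q" "q \<in> Q" "q dvd n" by (auto simp: F_def)
    then have "F q = {q}" using F_prod[of "{q}"] by simp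
    then have "coprime q (\<Prod>T)" using coprime_prod_iff[OF \<open>T \<subseteq> Q\<close>] insert by auto
    then show ?case using insert \<open>q dvd n\<close> by (simp add: divides_mult)
  qed simp
qed

lemma prod_sieving_primes_pos: "T \<subseteq> Q \<Longrightarrow> 1 \<le> \<Prod>T"
  using prime_Q prime_ge_1_nat by (intro prod_ge_1) blast

text \<open>The total weight that \<open>n\<close> receives from its moduli. The restriction
  \<open>F r = {}\<close> loses nothing when \<open>n\<close> survives the sieve, and makes the
  weight insensitive to sieving primes.\<close>

definition G :: "real \<Rightarrow> (nat \<Rightarrow> complex) \<Rightarrow> nat \<Rightarrow> complex" where
  "G R c n = (\<Sum>r | 1 \<le> r \<and> real r \<le> R \<and> F r = {} \<and> r dvd n. c r)"

lemma finite_real_le: "finite {r :: nat. 1 \<le> r \<and> real r \<le> R}"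
  by (rule finite_subset[of _ "{..nat \<lfloor>R\<rfloor>}"]) (auto simp: le_nat_floor)

lemma norm_G_le:
  assumes "\<And>r. 1 \<le> r \<Longrightarrow> real r \<le> R \<Longrightarrow> norm (c r) \<le> 1" and "1 \<le> m"
  shows "norm (G R c m) \<le> real (tau6 m)"
proof -
  let ?X = "{r. 1 \<le> r \<and> real r \<le> R \<and> F r = {} \<and> r dvd m}"
  have fin: "finite {r. r dvd m}" using assms(2) by simp
  have "norm (G R c m) \<le> (\<Sum>r\<in>?X. 1)"
    unfolding G_def by (rule sum_norm_le) (use assms in auto)
  also have "\<dots> \<le> real (card {r. r dvd m})"
    using card_mono[OF fin, of ?X] by auto
  also have "\<dots> \<le> real (tau6 m)"
    using card_divisors_le_tau6[OF assms(2)] by simp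
  finally show ?thesis .
qed

text \<open>An \<open>r\<close> without sieving prime factors is coprime to \<open>\<Prod>T\<close>.
  In the type II sum this turns the weight of \<open>l * m\<close> into a function of
  \<open>m\<close> alone.\<close>

lemma G_mult:
  assumes "T \<subseteq> Q"
  shows "G R c (\<Prod>T * m) = G R c m"
proof -
  have "r dvd \<Prod>T * m \<longleftrightarrow> r dvd m" if "F r = {}" for r
    using coprime_prod_iff[OF assms, of r] that by (simp add: coprime_dvd_mult_right_iff)
  then show ?thesis
    unfolding G_def by (intro sum.cong) auto
qed

lemma sifted_sum_eq:
  assumes "finite S"
  shows "(\<Sum>r | 1 \<le> r \<and> real r \<le> R.
      c r * (\<Sum>n | n \<in> S \<and> coprime n (\<Prod>Q) \<and> r dvd n. 1)) =
    (\<Sum>n\<in>S. if F n = {} then G R c n else 0)"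
proof -
  have cop: "coprime n (\<Prod>Q) \<longleftrightarrow> F n = {}" for n
    using coprime_prod_iff[of Q n] F_subset by blast
  have "(\<Sum>r | 1 \<le> r \<and> real r \<le> R.
      c r * (\<Sum>n | n \<in> S \<and> coprime n (\<Prod>Q) \<and> r dvd n. 1)) =
    (\<Sum>r | 1 \<le> r \<and> real r \<le> R. \<Sum>n\<in>S. if F n = {} \<and> r dvd n then c r else 0)"
  proof (rule sum.cong)
    fix r
    have "c r * (\<Sum>n | n \<in> S \<and> coprime n (\<Prod>Q) \<and> r dvd n. 1) =
        (\<Sum>n\<in>{n \<in> S. F n = {} \<and> r dvd n}. c r)"
      unfolding cop by (simp add: mult.commute)
    then show "c r * (\<Sum>n | n \<in> S \<and> coprime n (\<Prod>Q) \<and> r dvd n. 1) =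
        (\<Sum>n\<in>S. if F n = {} \<and> r dvd n then c r else 0)"
      by (simp only: sum.inter_filter[OF assms])
  qed simp
  also have "\<dots> = (\<Sum>n\<in>S. \<Sum>r | 1 \<le> r \<and> real r \<le> R. if F n = {} \<and> r dvd n then c r else 0)"
    by (rule sum.swap)
  also have "\<dots> = (\<Sum>n\<in>S. if F n = {} then G R c n else 0)"
  proof (rule sum.cong)
    fix n
    show "(\<Sum>r | 1 \<le> r \<and> real r \<le> R. if F n = {} \<and> r dvd n then c r else 0) =
        (if F n = {} then G R c n else 0)"
    proof (cases "F n = {}")
      case True
      \<comment> \<open>Divisors of a surviving \<open>n\<close> survive too, so
        \<open>F r = {}\<close> holds automatically.\<close>
      then have "{r. 1 \<le> r \<and> real r \<le> R \<and> F r = {} \<and> r dvd n} =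
          {r \<in> {r. 1 \<le> r \<and> real r \<le> R}. r dvd n}"
        using F_dvd by blast
      then show ?thesis
        using True unfolding G_def by (simp only: sum.inter_filter[OF finite_real_le]) simp
    qed simp
  qed simp
  finally show ?thesis .
qed

section \<open>Type I part: small products of sieving primes\<close>

text \<open>If the square of a sieving prime divides \<open>e\<close>, that prime still divides the
  quotient, so such an \<open>e\<close> gets coefficient 0.\<close>

definition coeff_I :: "real \<Rightarrow> real \<Rightarrow> (nat \<Rightarrow> complex) \<Rightarrow> nat \<Rightarrow> complex" where
  "coeff_I L R c e =
    (if real (\<Prod>(F e)) \<le> L \<and> F (e div \<Prod>(F e)) = {} \<and> real (e div \<Prod>(F e)) \<le> R
     then (-1) ^ card (F e) * c (e div \<Prod>(F e)) else 0)"

lemma div_prod_F_pos: "1 \<le> e \<Longrightarrow> 1 \<le> e div \<Prod>(F e)"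
  using prod_dvd[of "F e" e] by (auto simp: Suc_le_eq dvd_div_eq_0_iff intro!: Nat.gr0I)

lemma norm_coeff_I_le:
  assumes "\<And>r. 1 \<le> r \<Longrightarrow> real r \<le> R \<Longrightarrow> norm (c r) \<le> 1" and "1 \<le> e"
  shows "norm (coeff_I L R c e) \<le> 1"
  using assms(1)[OF div_prod_F_pos[OF assms(2)]]
  by (simp add: coeff_I_def norm_mult norm_power)

text \<open>Since \<open>r\<close> has no prime factor in \<open>Q\<close>, both \<open>T\<close> and \<open>r\<close> can be read off \<open>e = r * \<Prod>T\<close>;
  this is why the coefficients are bounded by 1 rather than by a divisor function.\<close>

lemma small_part_eq:
  assumes "1 \<le> n" and D: "\<And>r d :: nat. real r \<le> R \<Longrightarrow> real d \<le> L \<Longrightarrow> real (r * d) < D"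
  shows "(\<Sum>T | T \<subseteq> F n \<and> real (\<Prod>T) \<le> L. (-1) ^ card T) * G R c n =
    (\<Sum>e | 1 \<le> e \<and> real e < D \<and> e dvd n. coeff_I L R c e)"
proof -
  let ?TT = "{T. T \<subseteq> F n \<and> real (\<Prod>T) \<le> L}"
  let ?RR = "{r. 1 \<le> r \<and> real r \<le> R \<and> F r = {} \<and> r dvd n}"
  let ?E = "{e. 1 \<le> e \<and> real e < D \<and> e dvd n}"
  let ?E' = "{e \<in> ?E. real (\<Prod>(F e)) \<le> L \<and> F (e div \<Prod>(F e)) = {} \<and> real (e div \<Prod>(F e)) \<le> R}"
  have finE: "finite ?E"
    by (rule finite_subset[of _ "{e. e dvd n}"]) (use assms(1) in auto)
  have "(\<Sum>T\<in>?TT. (-1) ^ card T) * G R c n = (\<Sum>(T, r)\<in>?TT \<times> ?RR. (-1) ^ card T * c r)"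
    unfolding G_def by (simp add: sum_product sum.cartesian_product)
  also have "\<dots> = (\<Sum>e\<in>?E'. (-1) ^ card (F e) * c (e div \<Prod>(F e)))"
  proof (rule sum.reindex_bij_witness[of _ "\<lambda>e. (F e, e div \<Prod>(F e))" "\<lambda>(T, r). r * \<Prod>T"])
    fix x assume "x \<in> ?TT \<times> ?RR"
    then obtain T r where x: "x = (T, r)" and T: "T \<subseteq> F n" "real (\<Prod>T) \<le> L"
      and r: "1 \<le> r" "real r \<le> R" "F r = {}" "r dvd n" by blast
    have TQ: "T \<subseteq> Q" using T F_subset by blast
    have FT: "F (r * \<Prod>T) = T" using r TQ by (simp add: F_mult F_prod)
    have pos: "1 \<le> \<Prod>T" using prod_sieving_primes_pos[OF TQ] .
    then have quot: "r * \<Prod>T div \<Prod>T = r" by (intro nonzero_mult_div_cancel_right) linarith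
    \<comment> \<open>Coprimality merges the conditions that \<open>r\<close> and
      \<open>\<Prod>T\<close> divide \<open>n\<close> into one divisibility, as a type I sum
      requires.\<close>
    have "coprime r (\<Prod>T)" using coprime_prod_iff[OF TQ] r by simp
    then have "r * \<Prod>T dvd n" using r prod_dvd[OF T(1)] by (simp add: divides_mult)
    moreover have "1 \<le> r * \<Prod>T" using r pos by (metis mult_le_mono nat_mult_1)
    moreover have "real (r * \<Prod>T) < D" using D r T by blast
    ultimately show "(case x of (T, r) \<Rightarrow> r * \<Prod>T) \<in> ?E'"
      using FT quot r T by (simp add: x del: of_nat_prod of_nat_mult)
    show "(F (case x of (T, r) \<Rightarrow> r * \<Prod>T), (case x of (T, r) \<Rightarrow> r * \<Prod>T) div
        \<Prod>(F (case x of (T, r) \<Rightarrow> r * \<Prod>T))) = x"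
      using FT quot by (simp add: x)
    show "(-1) ^ card (F (case x of (T, r) \<Rightarrow> r * \<Prod>T)) *
        c ((case x of (T, r) \<Rightarrow> r * \<Prod>T) div \<Prod>(F (case x of (T, r) \<Rightarrow> r * \<Prod>T))) =
        (case x of (T, r) \<Rightarrow> (-1) ^ card T * c r)"
      using FT quot by (simp add: x)
  next
    fix e assume e: "e \<in> ?E'"
    have dvd: "\<Prod>(F e) dvd e" by (rule prod_dvd) simp
    then show "(case (F e, e div \<Prod>(F e)) of (T, r) \<Rightarrow> r * \<Prod>T) = e" by simp
    have "e div \<Prod>(F e) dvd e" using dvd by (metis dvd_div_mult_self dvd_triv_left)
    then have "e div \<Prod>(F e) dvd n" using e by (auto intro: dvd_trans)
    then show "(F e, e div \<Prod>(F e)) \<in> ?TT \<times> ?RR"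
      using e F_dvd[of e n] div_prod_F_pos[of e] by (simp del: of_nat_prod)
  qed
  also have "\<dots> = (\<Sum>e\<in>?E. coeff_I L R c e)"
    unfolding sum.inter_filter[OF finE] coeff_I_def ..
  finally show ?thesis .
qed

section \<open>Type II part: products that cross \<open>L\<close>\<close>

text \<open>\<open>\<Prod>(F l) = l\<close> says that \<open>l\<close> is a squarefree product of
  sieving primes. The condition \<open>L < l\<close> comes from the range of summation; together
  they say that the least prime carries the product past \<open>L\<close>.\<close>

definition coeff_II :: "real \<Rightarrow> nat \<Rightarrow> complex" where
  "coeff_II L l = (if \<Prod>(F l) = l \<and> F l \<noteq> {} \<and> real (\<Prod>(F l - {Min (F l)})) \<le> L
     then (-1) ^ card (F l) else 0)"

lemma norm_coeff_II_le: "norm (coeff_II L l) \<le> 1"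
  by (simp add: coeff_II_def norm_power)

text \<open>Inserting \<open>M\<close> gives a value when \<open>n\<close> has no sieving prime, and
  bounds all values, so that finitely many binary digits suffice.\<close>

definition cut :: "nat \<Rightarrow> nat \<Rightarrow> nat" where
  "cut M n = Min (insert M (F n))"

lemma cut_le: "cut M n \<le> M"
  using finite_F by (simp add: cut_def)

text \<open>\<open>triangular\<close> wants a strict inequality, but a prime may divide both
  \<open>l\<close> and \<open>m\<close>; \<open>Suc\<close> allows equality. As
  \<open>Min (F l) \<le> l \<le> M\<close>, truncation at \<open>M\<close> does not affect the
  comparison.\<close>

lemma cut_less_Suc_cut_iff:
  assumes "F l \<noteq> {}" and "1 \<le> l" and "l \<le> M"
  shows "cut M l < Suc (cut M m) \<longleftrightarrow> (\<forall>q\<in>F m. Min (F l) \<le> q)"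
proof -
  have "Min (F l) \<in> F l" using assms finite_F by simp
  then have "Min (F l) \<le> l" using assms(2) by (auto simp: F_def intro: dvd_imp_le)
  then have "cut M l = Min (F l)" "Min (F l) \<le> M"
    using assms finite_F by (auto simp: cut_def)
  then show ?thesis
    using finite_F by (simp add: cut_def less_Suc_eq_le)
qed

text \<open>Pass from \<open>(n, U)\<close> to \<open>(l, m)\<close> with
  \<open>l = \<Prod>U\<close> and \<open>n = l * m\<close>; conversely \<open>U = F l\<close>. Since
  \<open>F n\<close> is the union of \<open>F l\<close> and \<open>F m\<close>, minimality of
  \<open>Min U\<close> becomes a comparison of \<open>l\<close> with \<open>m\<close>.\<close>

lemma large_part_eq:
  assumes S: "finite S" "\<And>n. n \<in> S \<Longrightarrow> 1 \<le> n \<and> n \<le> M" and "0 \<le> L"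
    and z: "\<And>q. q \<in> Q \<Longrightarrow> real q \<le> z"
  shows "(\<Sum>n\<in>S. (\<Sum>U | U \<subseteq> F n \<and> U \<noteq> {} \<and> real (\<Prod>(U - {Min U})) \<le> L \<and>
        L < real (\<Prod>U) \<and> (\<forall>q\<in>F n. Min U \<le> q). (-1) ^ card U) * G R c n) =
    (\<Sum>(l, m) | L < real l \<and> real l \<le> z * L \<and> 1 \<le> m \<and> l * m \<in> S.
        if cut M l < Suc (cut M m) then coeff_II L l * G R c m else 0)"
proof -
  define \<U> where "\<U> = (\<lambda>n. {U. U \<subseteq> F n \<and> U \<noteq> {} \<and> real (\<Prod>(U - {Min U})) \<le> L \<and>
        L < real (\<Prod>U) \<and> (\<forall>q\<in>F n. Min U \<le> q)})"
  define X where "X = {(l, m). L < real l \<and> real l \<le> z * L \<and> 1 \<le> m \<and> l * m \<in> S}"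
  define W where "W = (\<lambda>(l, m). \<Prod>(F l) = l \<and> F l \<noteq> {} \<and> real (\<Prod>(F l - {Min (F l)})) \<le> L \<and>
        cut M l < Suc (cut M m))"
  have fin\<U>: "finite (\<U> n)" for n
    unfolding \<U>_def by (rule finite_subset[of _ "Pow (F n)"]) (use finite_F in auto)
  have X_le: "1 \<le> l \<and> l \<le> M \<and> m \<le> M" if "(l, m) \<in> X" for l m
  proof -
    have "1 \<le> l" "1 \<le> m" "l * m \<le> M" using that S \<open>0 \<le> L\<close> by (auto simp: X_def)
    moreover have "l \<le> l * m" "m \<le> l * m" using calculation by auto
    ultimately show ?thesis by linarith
  qed
  have finX: "finite X"
    by (rule finite_subset[of _ "{..M} \<times> {..M}"]) (use X_le in auto)
  have "(\<Sum>n\<in>S. (\<Sum>U\<in>\<U> n. (-1) ^ card U) * G R c n) =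
      (\<Sum>(n, U)\<in>Sigma S \<U>. (-1) ^ card U * G R c n)"
    using S fin\<U> by (simp add: sum_distrib_right sum.Sigma)
  also have "\<dots> = (\<Sum>(l, m)\<in>{x \<in> X. W x}. (-1) ^ card (F l) * G R c m)"
  proof (rule sum.reindex_bij_witness[of _ "\<lambda>(l, m). (l * m, F l)" "\<lambda>(n, U). (\<Prod>U, n div \<Prod>U)"])
    fix x assume "x \<in> Sigma S \<U>"
    then obtain n U where x: "x = (n, U)" and n: "n \<in> S" and U: "U \<subseteq> F n" "U \<noteq> {}"
      "real (\<Prod>(U - {Min U})) \<le> L" "L < real (\<Prod>U)" "\<forall>q\<in>F n. Min U \<le> q"
      by (auto simp: \<U>_def)
    have UQ: "U \<subseteq> Q" using U F_subset by blast
    have finU: "finite U" using UQ finite_Q finite_subset by blast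
    have FU: "F (\<Prod>U) = U" by (rule F_prod[OF UQ])
    obtain m where m: "n = \<Prod>U * m" using prod_dvd[OF U(1)] by blast
    have quot: "n div \<Prod>U = m" using m prod_sieving_primes_pos[OF UQ] by simp
    have "1 \<le> m" using S(2)[OF n] m by (cases m) auto
    have Min_in: "Min U \<in> U" using U finU by simp
    \<comment> \<open>Without its least prime the product is at most \<open>L\<close>, and that
      prime is at most \<open>z\<close>: hence the upper end \<open>z * L\<close> of the type II
      range.\<close>
    have "real (\<Prod>U) = real (Min U) * real (\<Prod>(U - {Min U}))"
      using prod.remove[OF finU Min_in, of "\<lambda>x. x"] by (metis of_nat_mult)
    also have "\<dots> \<le> z * L"
      using U(3) z[of "Min U"] Min_in UQ
      by (intro mult_mono) (auto intro: order_trans[OF of_nat_0_le_iff] simp del: of_nat_prod)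
    finally have inX: "(\<Prod>U, m) \<in> X"
      using U n m \<open>1 \<le> m\<close> by (simp add: X_def)
    have "\<forall>q\<in>F m. Min (F (\<Prod>U)) \<le> q"
      using U(5) m FU by (simp add: F_mult)
    then have "cut M (\<Prod>U) < Suc (cut M m)"
      using cut_less_Suc_cut_iff[of "\<Prod>U" M m] X_le[OF inX] U(2) FU by metis
    then show "(case x of (n, U) \<Rightarrow> (\<Prod>U, n div \<Prod>U)) \<in> {x \<in> X. W x}"
      using inX U FU quot by (simp add: x W_def del: of_nat_prod)
    show "(case (case x of (n, U) \<Rightarrow> (\<Prod>U, n div \<Prod>U)) of (l, m) \<Rightarrow> (l * m, F l)) = x"
      using FU quot m by (simp add: x)
    show "(case (case x of (n, U) \<Rightarrow> (\<Prod>U, n div \<Prod>U)) of (l, m) \<Rightarrow>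
        (-1) ^ card (F l) * G R c m) = (case x of (n, U) \<Rightarrow> (-1) ^ card U * G R c n)"
      using FU quot m G_mult[OF UQ] by (simp add: x)
  next
    fix y assume "y \<in> {x \<in> X. W x}"
    then obtain l m where y: "y = (l, m)" and inX: "(l, m) \<in> X" and W: "\<Prod>(F l) = l" "F l \<noteq> {}"
      "real (\<Prod>(F l - {Min (F l)})) \<le> L" "cut M l < Suc (cut M m)"
      by (auto simp: W_def)
    have "1 \<le> l" "l \<le> M" using X_le[OF inX] by auto
    then have "\<forall>q\<in>F m. Min (F l) \<le> q"
      using cut_less_Suc_cut_iff W by blast
    then have "F l \<in> \<U> (l * m)"
      using W inX finite_F by (auto simp: \<U>_def F_mult X_def simp del: of_nat_prod)
    then show "(case y of (l, m) \<Rightarrow> (l * m, F l)) \<in> Sigma S \<U>"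
      using inX by (simp add: y X_def)
    show "(case (case y of (l, m) \<Rightarrow> (l * m, F l)) of (n, U) \<Rightarrow> (\<Prod>U, n div \<Prod>U)) = y"
      using W \<open>1 \<le> l\<close> by (simp add: y)
  qed
  also have "\<dots> = (\<Sum>x\<in>X. if W x then (case x of (l, m) \<Rightarrow> (-1) ^ card (F l) * G R c m) else 0)"
    by (rule sum.inter_filter[OF finX])
  also have "\<dots> = (\<Sum>(l, m)\<in>X. if cut M l < Suc (cut M m) then coeff_II L l * G R c m else 0)"
    by (rule sum.cong) (simp_all add: W_def coeff_II_def case_prod_unfold)
  finally show ?thesis unfolding \<U>_def X_def .
qed

end

section \<open>Number of digits and final estimate\<close>

text \<open>\<open>J\<close> digits hold every value of \<open>cut M\<close> and its successor. From
  2^n <= M + 1 <= N^2 and e <= 4 follows n <= 4 ln N; the one extra digit is paid for by ln N >=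
  1.\<close>

lemma ex_power2_gt_log:
  assumes "3 \<le> N" and "real M \<le> N"
  obtains J where "Suc M < 2 ^ J" and "real J \<le> 5 * ln N"
proof -
  obtain n where n: "2 ^ n \<le> Suc M" "Suc M < 2 ^ (n + 1)"
    using ex_power_ivl1[of 2 "Suc M"] by auto
  have "exp (real n) = exp 1 ^ n"
    by (simp add: exp_of_nat_mult[symmetric])
  also have "\<dots> \<le> 4 ^ n"
    using exp_le by (intro power_mono) auto
  also have "\<dots> = (2 ^ n)\<^sup>2"
    by (simp add: power2_eq_square power_mult_distrib[symmetric])
  also have "\<dots> \<le> (N\<^sup>2)\<^sup>2"
  proof (rule power_mono)
    have "(2 :: real) ^ n \<le> real (Suc M)"
      using n(1) by (metis of_nat_le_iff of_nat_numeral of_nat_power)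
    also have "\<dots> \<le> 3 * N" using assms by simp
    also have "\<dots> \<le> N\<^sup>2"
      using assms by (simp add: power2_eq_square)
    finally show "2 ^ n \<le> N\<^sup>2" .
  qed simp
  also have "\<dots> = exp (4 * ln N)"
    using assms by (simp add: exp_of_nat_mult[of 4, simplified])
  finally have "real n \<le> 4 * ln N" by simp
  moreover have "1 \<le> ln N"
    using assms exp_le by (subst ln_ge_iff) auto
  ultimately show ?thesis
    using n(2) by (intro that[of "n + 1"]) auto
qed

theorem theorem6p1:
  fixes P :: "nat set" and \<kappa> K1 K2 :: real
  assumes "infinite P" and "\<And>p. p \<in> P \<Longrightarrow> prime p"
    and "0 < \<kappa>" and "\<kappa> \<le> 1" and "has_log_density P \<kappa>"
  shows "\<exists>C N0 :: real. \<forall>(N :: real) (z :: real) (A :: nat set) (B :: nat set)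
           (D :: real) (\<alpha> :: real) (lam :: complex) (Y :: real).
           N0 \<le> N \<and> 1 \<le> z \<and>
           (\<forall>n\<in>A. 1 \<le> n \<and> real n \<le> N) \<and> (\<forall>n\<in>B. 1 \<le> n \<and> real n \<le> N) \<and>
           1 \<le> D \<and> 0 < \<alpha> \<and> \<alpha> < 1 \<and> 2 \<le> Y \<and>
           type_I_estimate K1 A B lam D Y \<and>
           type_II_estimate K2 A B lam (N powr \<alpha>) z Y \<longrightarrow>
           (\<forall>(R :: real) (c :: nat \<Rightarrow> complex).
              1 \<le> R \<and> N powr \<alpha> * R \<le> D \<and> (N powr \<alpha> * R = D \<longrightarrow> D \<notin> \<nat>) \<and>
              (\<forall>r. 1 \<le> r \<and> real r \<le> R \<longrightarrow> norm (c r) \<le> 1) \<longrightarrow>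
              norm (sifted_sum P A z R c - lam * sifted_sum P B z R c)
                \<le> C * (Y * ln N + R * N / z))"
proof (rule exI[of _ "\<bar>K1\<bar> + 5 * \<bar>K2\<bar>"], rule exI[of _ 3], intro allI impI, (elim conjE)+)
  \<comment> \<open>The 5 comes from the digit count \<open>J \<le> 5 * ln N\<close>. Absolute
    values appear because \<open>K1\<close> and \<open>K2\<close> may have any sign, and
    \<open>N \<ge> 3\<close> ensures \<open>1 \<le> ln N\<close>.\<close>
  fix N z :: real and A B :: "nat set" and D \<alpha> :: real and lam :: complex and Y R :: real
    and c :: "nat \<Rightarrow> complex"
  assume N: "3 \<le> N" and z: "1 \<le> z"
    and A: "\<forall>n\<in>A. 1 \<le> n \<and> real n \<le> N" and B: "\<forall>n\<in>B. 1 \<le> n \<and> real n \<le> N"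
    and \<alpha>: "0 < \<alpha>" and Y: "2 \<le> Y"
    and I: "type_I_estimate K1 A B lam D Y"
    and II: "type_II_estimate K2 A B lam (N powr \<alpha>) z Y"
    and R: "1 \<le> R" "N powr \<alpha> * R \<le> D" "N powr \<alpha> * R = D \<longrightarrow> D \<notin> \<nat>"
    and c: "\<forall>r. 1 \<le> r \<and> real r \<le> R \<longrightarrow> norm (c r) \<le> 1"
  define L where "L = N powr \<alpha>"
  define Q where "Q = {p \<in> P. real p < z}"
  define M where "M = nat \<lfloor>N\<rfloor>"
  have L: "1 \<le> L" using N \<alpha> by (simp add: L_def ge_one_powr_ge_zero)
  have "finite Q"
    by (rule finite_subset[of _ "{..nat \<lfloor>z\<rfloor>}"]) (auto simp: Q_def le_nat_floor)
  then interpret sieve Q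
    using assms(2) by unfold_locales (auto simp: Q_def)
  have le_M: "n \<le> M" if "real n \<le> N" for n
    using that by (simp add: M_def le_nat_floor)
  have M: "real M \<le> N" using N by (simp add: M_def)
  obtain J where J: "Suc M < 2 ^ J" "real J \<le> 5 * ln N"
    using ex_power2_gt_log[OF N M] .
  \<comment> \<open>\<open>r * d \<le> L * R \<le> D\<close>, and equality throughout would make
    \<open>D\<close> a natural number, which is excluded. So every modulus lies in the strict type I
    range.\<close>
  have small: "real (r * d) < D" if "real r \<le> R" "real d \<le> L" for r d :: nat
  proof -
    have "real (r * d) \<le> L * R"
      using that L by (simp add: mult.commute[of "real r"] mult_mono)
    moreover have "real (r * d) \<noteq> D" if "L * R = D"
      using R(3) that by (metis L_def of_nat_in_Nats)
    ultimately show ?thesis using R(2) unfolding L_def by fastforce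
  qed
  define X where "X = (\<lambda>S. {(l, m). L < real l \<and> real l \<le> z * L \<and> 1 \<le> m \<and> l * m \<in> S})"
  define E where "E = (\<lambda>f. (\<Sum>(l, m)\<in>X A. f l m) - lam * (\<Sum>(l, m)\<in>X B. f l m))"
  \<comment> \<open>Positive integers never multiply to 0, so \<open>tau6 0 = 0\<close>, whereas
    \<open>G R c 0\<close> sums over all moduli free of sieving primes. Setting
    \<open>b 0 = 0\<close> restores the bound and changes no sum, as \<open>m \<ge> 1\<close>
    there.\<close>
  define b where "b = (\<lambda>m. if m = 0 then 0 else G R c m)"
  define g where "g = (\<lambda>l m. if cut M l < Suc (cut M m) then coeff_II L l * b m else 0)"
  interpret bilinear_bound E "K2 * Y" "\<lambda>m. real (tau6 m)"
  proof
    fix f g :: "nat \<Rightarrow> nat \<Rightarrow> complex" and k :: complex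
    show "E (\<lambda>l m. f l m + g l m) = E f + E g"
      by (simp add: E_def case_prod_unfold sum.distrib algebra_simps)
    show "E (\<lambda>l m. k * f l m) = k * E f"
      by (simp add: E_def case_prod_unfold sum_distrib_left algebra_simps)
  next
    fix a b :: "nat \<Rightarrow> complex"
    assume "\<And>l. norm (a l) \<le> 1" "\<And>m. norm (b m) \<le> real (tau6 m)"
    then show "norm (E (\<lambda>l m. a l * b m)) \<le> K2 * Y"
      using II unfolding type_II_estimate_def E_def X_def sum_II_def L_def by blast
  qed
  \<comment> \<open>Neither the type I coefficients nor \<open>g\<close> depend on \<open>S\<close>,
    so the sifted sums of \<open>A\<close> and \<open>B\<close> can be compared piece by
    piece.\<close>
  have decomp: "sifted_sum P S z R c = sum_I S D (coeff_I L R c) + (\<Sum>(l, m)\<in>X S. g l m)"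
    if S: "\<forall>n\<in>S. 1 \<le> n \<and> real n \<le> N" for S
  proof -
    have SM: "1 \<le> n \<and> n \<le> M" if "n \<in> S" for n using S that le_M by blast
    then have finS: "finite S" by (intro finite_subset[of S "{..M}"]) auto
    have fin_dvd: "finite {e. 1 \<le> e \<and> real e < D \<and> e dvd n}" if "n \<in> S" for n
      by (rule finite_subset[of _ "{e. e dvd n}"]) (use SM[OF that] in auto)
    have "sifted_sum P S z R c = (\<Sum>n\<in>S. (if F n = {} then 1 else 0) * G R c n)"
      unfolding sifted_sum_def sieve_prod_def Q_def[symmetric] sifted_sum_eq[OF finS]
      by (rule sum.cong) auto
    also have "\<dots> = (\<Sum>n\<in>S. \<Sum>e | 1 \<le> e \<and> real e < D \<and> e dvd n. coeff_I L R c e) +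
       (\<Sum>n\<in>S. (\<Sum>U | U \<subseteq> F n \<and> U \<noteq> {} \<and> real (\<Prod>(U - {Min U})) \<le> L \<and>
         L < real (\<Prod>U) \<and> (\<forall>q\<in>F n. Min U \<le> q). (-1) ^ card U) * G R c n)"
      unfolding sum.distrib[symmetric]
    proof (rule sum.cong)
      fix n assume "n \<in> S"
      then show "(if F n = {} then 1 else 0) * G R c n =
        (\<Sum>e | 1 \<le> e \<and> real e < D \<and> e dvd n. coeff_I L R c e) +
        (\<Sum>U | U \<subseteq> F n \<and> U \<noteq> {} \<and> real (\<Prod>(U - {Min U})) \<le> L \<and>
         L < real (\<Prod>U) \<and> (\<forall>q\<in>F n. Min U \<le> q). (-1) ^ card U) * G R c n"
        using SM small_part_eq[of n R L D c] small
        by (subst crossing_identity[OF finite_F F_ge_1 L]) (auto simp only: distrib_right)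
    qed simp
    also have "(\<Sum>n\<in>S. \<Sum>e | 1 \<le> e \<and> real e < D \<and> e dvd n. coeff_I L R c e) =
        sum_I S D (coeff_I L R c)"
    proof -
      have "(\<Sum>n\<in>S. \<Sum>e | 1 \<le> e \<and> real e < D \<and> e dvd n. coeff_I L R c e) =
          (\<Sum>(n, e)\<in>(SIGMA n:S. {e. 1 \<le> e \<and> real e < D \<and> e dvd n}). coeff_I L R c e)"
        using finS fin_dvd by (intro sum.Sigma) auto
      also have "\<dots> = sum_I S D (coeff_I L R c)"
        unfolding sum_I_def
        by (rule sum.reindex_bij_witness[of _ prod.swap prod.swap]) auto
      finally show ?thesis .
    qed
    also have "(\<Sum>n\<in>S. (\<Sum>U | U \<subseteq> F n \<and> U \<noteq> {} \<and> real (\<Prod>(U - {Min U})) \<le> L \<and>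
         L < real (\<Prod>U) \<and> (\<forall>q\<in>F n. Min U \<le> q). (-1) ^ card U) * G R c n) =
        (\<Sum>(l, m)\<in>X S. g l m)"
      using L unfolding X_def
      by (subst large_part_eq[OF finS SM, where z = z])
        (auto simp: Q_def g_def b_def intro!: sum.cong)
    finally show ?thesis .
  qed
  have "sifted_sum P A z R c - lam * sifted_sum P B z R c =
      (sum_I A D (coeff_I L R c) - lam * sum_I B D (coeff_I L R c)) + E g"
    unfolding decomp[OF A] decomp[OF B] E_def by (simp add: algebra_simps)
  moreover have "norm (sum_I A D (coeff_I L R c) - lam * sum_I B D (coeff_I L R c)) \<le> K1 * Y"
    using I norm_coeff_I_le[of R c] c unfolding type_I_estimate_def by blast
  moreover have "norm (E g) \<le> real J * (K2 * Y)"
    unfolding g_def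
  proof (rule triangular)
    fix m
    show "norm (b m) \<le> real (tau6 m)"
      using norm_G_le[of R c m] c by (auto simp: b_def)
  next
    fix n
    show "cut M n < 2 ^ J" "Suc (cut M n) < 2 ^ J"
      using cut_le[of M n] J(1) by linarith+
  qed (rule norm_coeff_II_le)
  ultimately have "norm (sifted_sum P A z R c - lam * sifted_sum P B z R c) \<le>
      K1 * Y + real J * (K2 * Y)"
    by (simp only:) (rule order_trans[OF norm_triangle_ineq add_mono])
  also have "\<dots> \<le> \<bar>K1\<bar> * (Y * ln N) + (5 * ln N) * (\<bar>K2\<bar> * Y)"
  proof (rule add_mono)
    have "1 \<le> ln N" using N exp_le by (subst ln_ge_iff) auto
    then have "1 * Y \<le> ln N * Y" using Y by (intro mult_right_mono) auto
    then show "K1 * Y \<le> \<bar>K1\<bar> * (Y * ln N)"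
      using Y by (intro mult_mono) (auto simp: mult.commute)
    show "real J * (K2 * Y) \<le> (5 * ln N) * (\<bar>K2\<bar> * Y)"
    proof -
      have "real J * (K2 * Y) \<le> real J * (\<bar>K2\<bar> * Y)"
        using Y by (intro mult_left_mono mult_right_mono) auto
      also have "\<dots> \<le> (5 * ln N) * (\<bar>K2\<bar> * Y)"
        using J Y by (intro mult_right_mono) auto
      finally show ?thesis .
    qed
  qed
  also have "\<dots> = (\<bar>K1\<bar> + 5 * \<bar>K2\<bar>) * (Y * ln N)" by (simp add: algebra_simps)
  also have "\<dots> \<le> (\<bar>K1\<bar> + 5 * \<bar>K2\<bar>) * (Y * ln N + R * N / z)"
    using R N z by (intro mult_left_mono) auto
  finally show "norm (sifted_sum P A z R c - lam * sifted_sum P B z R c) \<le>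
      (\<bar>K1\<bar> + 5 * \<bar>K2\<bar>) * (Y * ln N + R * N / z)" .
qed

end
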